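(* For every nonnegative integer $k$ and every lasso sequence $\mathbf x(\mathbf y)$ we have $$\phi^{(k+1)}\left(\mathbf x^{(1)}\left(\mathbf y^{(1)}\right)\right)=2^{k-1}\phi^{(k)}(\mathbf x(\mathbf y)).$$
   Context: For finite real sequences $\mathbf x\in\mathbb{R}^p$, $\mathbf y\in\mathbb{R}^q$ ($p\ge0$, $q\ge1$), the lasso sequence $\mathbf x(\mathbf y)$ is the infinite sequence listing the elements of $\mathbf x$ and then repeating $\mathbf y$ cyclically forever. For a sequence $\mathbf x=(x_1,x_2,\dots)$, its split is $\mathbf x^{(1)}=(x_1,-x_1,x_2,-x_2,\dots)$. For an infinite real sequence $\mathbf a$, $M(\mathbf a)=(a_1,a_1+a_2,a_1+a_2+a_3,\dots)$, $M^0$ is the identity, $M^k=M\circ M^{k-1}$, $A(\mathbf a)=\liminf_{T\to\infty}\frac1T\sum_{j=1}^T a_j$, and $\phi^{(k)}(\mathbf a)=A(M^k(\mathbf a))\in\mathbb{R}\cup\{\pm\infty\}$ (with $2^{k-1}\cdot(\pm\infty)=\pm\infty$). *)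

theory Defs
  imports "HOL-Analysis.Analysis"
begin

text \<open>Finite real sequences are lists; infinite ones are functions on \<^typ>\<open>nat\<close>,
  with index 0 holding the first term.\<close>

definition lasso :: "real list \<Rightarrow> real list \<Rightarrow> nat \<Rightarrow> real" where
  "lasso xs ys n =
     (if n < length xs then xs ! n else ys ! ((n - length xs) mod length ys))"

definition split_seq :: "real list \<Rightarrow> real list" where
  "split_seq xs = concat (map (\<lambda>x. [x, - x]) xs)"

definition partial_sums :: "(nat \<Rightarrow> real) \<Rightarrow> nat \<Rightarrow> real" where
  "partial_sums a n = (\<Sum>j\<le>n. a j)"

text \<open>The junk value at \<open>T = 0\<close> (division by zero) does not affect the limit inferior.\<close>

definition lower_average :: "(nat \<Rightarrow> real) \<Rightarrow> ereal" where
  "lower_average a = liminf (\<lambda>T. ereal ((1 / real T) * (\<Sum>j<T. a j)))"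

definition phi :: "nat \<Rightarrow> (nat \<Rightarrow> real) \<Rightarrow> ereal" where
  "phi k a = lower_average ((partial_sums ^^ k) a)"

end

theory Submission
  imports Defs
begin

text \<open>With \<open>z\<close> the shift, splitting turns a generating function \<open>a(z)\<close> into
  \<open>(1 - z) a(z\<^sup>2)\<close>, and \<open>M\<close> is division by \<open>1 - z\<close>. As \<open>1 - z\<^sup>2 = (1 - z) (1 + z)\<close>, applying
  \<open>M\<close> to the split \<open>k + 2\<close> times gives \<open>(1 + z)^(k + 1)\<close> times the generating function of
  \<open>c = M^(k + 1) a\<close> at \<open>z\<^sup>2\<close>. If \<open>c n / n\<close> tends to \<open>L\<close>, the first factor \<open>1 + z\<close> yields a
  sequence growing like \<open>(L / 2) n\<close>, and each of the remaining \<open>k\<close> factors doubles the growth rate.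
  The limit \<open>L\<close> exists (possibly infinite) because iterated partial sums of a lasso sequence stay
  eventually periodic until a nonzero mean appears; from then on they grow linearly once, and
  faster than linearly ever after.\<close>

text \<open>On generating functions this is multiplication by 1 + z; \<open>stretch\<close> replaces
  z by z^2.\<close>

definition add_shift :: "(nat \<Rightarrow> real) \<Rightarrow> nat \<Rightarrow> real" where
  "add_shift f n = f n + (if n = 0 then 0 else f (n - 1))"

definition stretch :: "(nat \<Rightarrow> real) \<Rightarrow> nat \<Rightarrow> real" where
  "stretch f n = (if even n then f (n div 2) else 0)"

text \<open>Dividing by \<open>Suc n\<close>, the number of terms up to index \<open>n\<close>,
  makes the growth rate of \<open>partial_sums f\<close> the limit of the averages of
  \<open>f\<close>.\<close>

definition growth :: "(nat \<Rightarrow> real) \<Rightarrow> ereal \<Rightarrow> bool" where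
  "growth f L \<longleftrightarrow> (\<lambda>n. ereal (f n / real (Suc n))) \<longlonglongrightarrow> L"

definition eventually_periodic :: "(nat \<Rightarrow> real) \<Rightarrow> bool" where
  "eventually_periodic f \<longleftrightarrow> (\<exists>N q. q > 0 \<and> (\<forall>n\<ge>N. f (n + q) = f n))"

section \<open>Algebra of partial sums, shifts and stretching\<close>

lemma partial_sums_0 [simp]: "partial_sums f 0 = f 0"
  by (simp add: partial_sums_def)

lemma partial_sums_Suc [simp]: "partial_sums f (Suc n) = partial_sums f n + f (Suc n)"
  by (simp add: partial_sums_def)

lemma partial_sums_add_shift: "partial_sums (add_shift f) = add_shift (partial_sums f)"
proof
  fix n show "partial_sums (add_shift f) n = add_shift (partial_sums f) n"
  proof (induction n)
    case (Suc n)
    then show ?case by (cases n) (simp_all add: add_shift_def)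
  qed (simp add: add_shift_def)
qed

lemma add_shift_stretch: "add_shift (stretch f) n = f (n div 2)"
  by (cases n) (auto simp: add_shift_def stretch_def)

text \<open>This is the identity 1 / (1 - z) = (1 + z) / (1 - z^2) applied to a(z^2).\<close>

lemma partial_sums_stretch: "partial_sums (stretch f) = add_shift (stretch (partial_sums f))"
proof
  fix n show "partial_sums (stretch f) n = add_shift (stretch (partial_sums f)) n"
    unfolding add_shift_stretch
  proof (induction n)
    case (Suc n)
    show ?case
    proof (cases "even n")
      case True
      then show ?thesis using Suc by (simp add: stretch_def)
    next
      case False
      then have "Suc n div 2 = Suc (n div 2)" by presburger
      then show ?thesis using Suc False by (simp add: stretch_def)
    qed
  qed (simp add: stretch_def)
qed

text \<open>Each pair a, -a cancels, so only the first half of an unfinished pair survives.\<close>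

lemma partial_sums_split:
  assumes "\<And>n. b n = (if even n then a (n div 2) else - a (n div 2))"
  shows "partial_sums b = stretch a"
proof
  fix n show "partial_sums b n = stretch a n"
  proof (induction n)
    case (Suc n)
    then show ?case by (auto simp: assms stretch_def)
  qed (simp add: assms stretch_def)
qed

lemma partial_sums_funpow_add_shift:
  "partial_sums ((add_shift ^^ k) f) = (add_shift ^^ k) (partial_sums f)"
  by (induction k) (simp_all add: partial_sums_add_shift)

lemma partial_sums_funpow_split:
  assumes "\<And>n. b n = (if even n then a (n div 2) else - a (n div 2))"
  shows "(partial_sums ^^ Suc k) b = (add_shift ^^ k) (stretch ((partial_sums ^^ k) a))"
proof (induction k)
  case 0
  show ?case using partial_sums_split[OF assms] by simp
next
  case (Suc k)
  have "(partial_sums ^^ Suc (Suc k)) b = partial_sums ((partial_sums ^^ Suc k) b)" by simp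
  \<comment> \<open>The outer sum passes through all \<open>k\<close> shifts and leaves one new
    shift when it crosses \<open>stretch\<close>.\<close>
  also have "\<dots> = (add_shift ^^ k) (add_shift (stretch ((partial_sums ^^ Suc k) a)))"
    unfolding Suc partial_sums_funpow_add_shift partial_sums_stretch by simp
  finally show ?case by (simp add: funpow_swap1)
qed

section \<open>Splitting a lasso termwise\<close>

lemma length_split_seq [simp]: "length (split_seq xs) = 2 * length xs"
  by (induction xs) (simp_all add: split_seq_def)

lemma nth_split_seq:
  assumes "n < 2 * length xs"
  shows "split_seq xs ! n = (if even n then xs ! (n div 2) else - xs ! (n div 2))"
  using assms
proof (induction xs arbitrary: n)
  case (Cons x xs)
  have eq: "split_seq (x # xs) = x # - x # split_seq xs" by (simp add: split_seq_def)
  consider "n = 0" | "n = 1" | m where "n = Suc (Suc m)"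
    by (metis One_nat_def old.nat.exhaust)
  then show ?case
    by cases (use Cons in \<open>auto simp: eq\<close>)
qed simp

lemma lasso_split_seq:
  assumes "ys \<noteq> []"
  shows "lasso (split_seq xs) (split_seq ys) n =
    (if even n then lasso xs ys (n div 2) else - lasso xs ys (n div 2))"
proof (cases "n < 2 * length xs")
  case True
  then show ?thesis by (simp add: lasso_def nth_split_seq less_mult_imp_div_less mult.commute)
next
  case False
  define m where "m = n - 2 * length xs"
  define r where "r = m mod (2 * length ys)"
  have n: "n = m + 2 * length xs" using False by (simp add: m_def)
  have q: "length ys > 0" using assms by simp
  have r: "r < 2 * length ys" using q by (simp add: r_def)
  \<comment> \<open>The prefix length and the period both double, so reduction modulo the period
    keeps parity.\<close>
  have par: "even r = even n" unfolding r_def n by (simp add: dvd_mod_iff)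
  have "r div 2 = m div 2 mod length ys"
    unfolding r_def by (simp add: mod_mult2_eq)
  also have "m div 2 = n div 2 - length xs" unfolding n by simp
  finally have dv: "r div 2 = (n div 2 - length xs) mod length ys" .
  have "lasso (split_seq xs) (split_seq ys) n = split_seq ys ! r"
    using False by (simp add: lasso_def r_def m_def)
  moreover have "lasso xs ys (n div 2) = ys ! (r div 2)"
  proof -
    have "\<not> n div 2 < length xs" using False by linarith
    then show ?thesis unfolding dv lasso_def by simp
  qed
  ultimately show ?thesis by (simp add: nth_split_seq[OF r] par)
qed

section \<open>Growth rates of iterated partial sums of a lasso\<close>

lemma eventually_periodic_lasso:
  assumes "ys \<noteq> []"
  shows "eventually_periodic (lasso xs ys)"
  unfolding eventually_periodic_def
proof (intro exI conjI allI impI)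
  show "length ys > 0" using assms by simp
  fix n assume "length xs \<le> n"
  then have "n + length ys - length xs = (n - length xs) + length ys" by simp
  then have "(n + length ys - length xs) mod length ys = (n - length xs) mod length ys" by simp
  with \<open>length xs \<le> n\<close> show "lasso xs ys (n + length ys) = lasso xs ys n"
    by (simp add: lasso_def)
qed

lemma eventually_periodic_bounded:
  assumes "eventually_periodic f"
  obtains B where "\<And>n. \<bar>f n\<bar> \<le> B"
proof -
  obtain N q where q: "q > 0" and per: "\<And>n. n \<ge> N \<Longrightarrow> f (n + q) = f n"
    using assms by (auto simp: eventually_periodic_def)
  have "f n \<in> f ` {..<N + q}" for n
  proof (induction n rule: less_induct)
    case (less n)
    show ?case
    proof (cases "n < N + q")
      case False
      then have "f n = f (n - q)" using per[of "n - q"] by simp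
      then show ?thesis using less[of "n - q"] False q by simp
    qed auto
  qed
  then have "range f \<subseteq> f ` {..<N + q}" by blast
  then have "bounded (range f)"
    by (meson finite_imageI finite_imp_bounded finite_lessThan bounded_subset)
  then show ?thesis using that by (auto simp: bounded_iff)
qed

lemma eventually_periodic_growth:
  assumes "eventually_periodic f"
  shows "growth f 0"
proof -
  obtain B where B: "\<And>n. \<bar>f n\<bar> \<le> B" using eventually_periodic_bounded[OF assms] by blast
  have "(\<lambda>n. B * (1 / real (Suc n))) \<longlonglongrightarrow> B * 0"
    by (intro tendsto_intros LIMSEQ_Suc lim_1_over_n)
  then have "(\<lambda>n. B / real (Suc n)) \<longlonglongrightarrow> 0" by simp
  then have "(\<lambda>n. f n / real (Suc n)) \<longlonglongrightarrow> 0"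
    by (rule Lim_null_comparison[rotated])
       (use B in \<open>auto intro!: always_eventually divide_right_mono\<close>)
  then show ?thesis by (simp add: growth_def zero_ereal_def)
qed

text \<open>The slope \<open>m\<close> is the mean of \<open>f\<close> over a period; removing this
  linear drift leaves a periodic tail.\<close>

lemma partial_sums_eventually_periodic:
  assumes "eventually_periodic f"
  obtains m where "eventually_periodic (\<lambda>n. partial_sums f n - m * real (Suc n))"
proof -
  obtain N q where q: "q > 0" and per: "\<And>n. n \<ge> N \<Longrightarrow> f (n + q) = f n"
    using assms by (auto simp: eventually_periodic_def)
  \<comment> \<open>\<open>h n\<close> sums \<open>f\<close> over the \<open>q\<close> indices after
    \<open>n\<close>, eventually one full period, so it becomes constant.\<close>
  define h where "h n = partial_sums f (n + q) - partial_sums f n" for n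
  have "h n = h N" if "n \<ge> N" for n
    using that
  proof (induction n rule: dec_induct)
    case (step n)
    then show ?case using per[of "Suc n"] by (simp add: h_def)
  qed simp
  then have "partial_sums f (n + q) = partial_sums f n + h N" if "n \<ge> N" for n
    using that unfolding h_def by (metis add.commute diff_add_cancel)
  then have "partial_sums f (n + q) - h N / real q * real (Suc (n + q)) =
      partial_sums f n - h N / real q * real (Suc n)" if "n \<ge> N" for n
    using that q by (simp add: field_simps)
  then have "eventually_periodic (\<lambda>n. partial_sums f n - h N / real q * real (Suc n))"
    using q unfolding eventually_periodic_def by blast
  then show ?thesis by (rule that)
qed

text \<open>Choosing a real c strictly between 0 and L, which also covers infinite L, bounds
  \<open>f\<close> below by a linear function from some index on; its sums then grow at least
  quadratically.\<close>

lemma growth_partial_sums_pos: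
  assumes f: "growth f L" and "L > 0"
  shows "growth (partial_sums f) \<infinity>"
proof -
  obtain c where c: "0 < ereal c" "ereal c < L" using ereal_dense2[OF \<open>L > 0\<close>] by blast
  have "\<forall>\<^sub>F n in sequentially. ereal c < ereal (f n / real (Suc n))"
    using f c(2) unfolding growth_def by (rule order_tendstoD(1))
  then obtain N where N: "\<And>n. n \<ge> N \<Longrightarrow> c < f n / real (Suc n)"
    by (auto simp: eventually_sequentially)
  \<comment> \<open>Closed form of the sum of c (j + 1) over j \<le> n; \<open>K\<close> absorbs the
    initial segment where the lower bound may fail.\<close>
  define g where "g n = c * (real (Suc n) * real (n + 2) / 2)" for n
  define K where "K = partial_sums f N - g N"
  have ge: "K + g n \<le> partial_sums f n" if "n \<ge> N" for n
    using that
  proof (induction n rule: dec_induct)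
    case base
    show ?case by (simp add: K_def)
  next
    case (step n)
    have "c * real (Suc (Suc n)) \<le> f (Suc n)"
      using N[of "Suc n"] step by (simp add: field_simps)
    moreover have "g (Suc n) = g n + c * real (Suc (Suc n))"
      by (simp add: g_def field_simps)
    ultimately show ?case using step by simp
  qed
  have "filterlim (\<lambda>n. K / real (Suc n) + c / 2 * real (n + 2)) at_top sequentially"
  proof (rule filterlim_tendsto_add_at_top)
    have "(\<lambda>n. K * (1 / real (Suc n))) \<longlonglongrightarrow> K * 0"
      by (intro tendsto_intros LIMSEQ_Suc lim_1_over_n)
    then show "(\<lambda>n. K / real (Suc n)) \<longlonglongrightarrow> 0" by simp
    have "filterlim (\<lambda>n. real (n + 2)) at_top sequentially"
      by (rule filterlim_compose[OF filterlim_real_sequentially filterlim_add_const_nat_at_top])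
    then show "filterlim (\<lambda>n. c / 2 * real (n + 2)) at_top sequentially"
      using c(1) by (intro filterlim_tendsto_pos_mult_at_top[OF tendsto_const]) auto
  qed
  moreover have "\<forall>\<^sub>F n in sequentially.
      K / real (Suc n) + c / 2 * real (n + 2) \<le> partial_sums f n / real (Suc n)"
    unfolding eventually_sequentially
  proof (intro exI allI impI)
    fix n assume "N \<le> n"
    have "K / real (Suc n) + c / 2 * real (n + 2) = (K + g n) / real (Suc n)"
      by (simp add: g_def field_simps)
    then show "K / real (Suc n) + c / 2 * real (n + 2) \<le> partial_sums f n / real (Suc n)"
      using ge[OF \<open>N \<le> n\<close>] by (simp add: divide_right_mono)
  qed
  ultimately have "filterlim (\<lambda>n. partial_sums f n / real (Suc n)) at_top sequentially"
    by (rule filterlim_at_top_mono)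
  then show ?thesis by (simp add: growth_def tendsto_PInfty_eq_at_top)
qed

lemma growth_minus: "growth f L \<Longrightarrow> growth (\<lambda>n. - f n) (- L)"
  unfolding growth_def by (drule tendsto_uminus_ereal) simp

lemma growth_partial_sums_nonzero:
  assumes f: "growth f L" and "L \<noteq> 0"
  obtains L' where "growth (partial_sums f) L'" "L' \<noteq> 0"
proof (cases "L > 0")
  case True
  then show ?thesis using that[of \<infinity>] growth_partial_sums_pos[OF f] by simp
next
  case False
  have "- L > 0" using False \<open>L \<noteq> 0\<close> by (cases L) auto
  with growth_minus[OF f] have "growth (partial_sums (\<lambda>n. - f n)) \<infinity>"
    by (rule growth_partial_sums_pos)
  then have "growth (\<lambda>n. - partial_sums (\<lambda>n. - f n) n) (- \<infinity>)" by (rule growth_minus)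
  moreover have "(\<lambda>n. - partial_sums (\<lambda>n. - f n) n) = partial_sums f"
    by (simp add: fun_eq_iff partial_sums_def sum_negf)
  ultimately show ?thesis using that[of "- \<infinity>"] by simp
qed

text \<open>This dichotomy is the induction invariant. Mere existence of a growth rate would not
  propagate: rate 0 alone says too little about the next partial sums, so that case carries
  periodicity instead.\<close>

lemma eventually_periodic_or_growth_partial_sums:
  assumes "eventually_periodic f \<or> (\<exists>L. L \<noteq> 0 \<and> growth f L)"
  shows "eventually_periodic (partial_sums f) \<or> (\<exists>L. L \<noteq> 0 \<and> growth (partial_sums f) L)"
  using assms
proof
  assume "eventually_periodic f"
  then obtain m where m: "eventually_periodic (\<lambda>n. partial_sums f n - m * real (Suc n))"
    by (rule partial_sums_eventually_periodic)
  show ?thesis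
  proof (cases "m = 0")
    case True
    then show ?thesis using m by simp
  next
    case False
    have "(\<lambda>n. (partial_sums f n - m * real (Suc n)) / real (Suc n)) \<longlonglongrightarrow> 0"
      using eventually_periodic_growth[OF m] by (simp add: growth_def zero_ereal_def)
    then have "(\<lambda>n. (partial_sums f n - m * real (Suc n)) / real (Suc n) + m) \<longlonglongrightarrow> 0 + m"
      by (intro tendsto_intros)
    then have "growth (partial_sums f) (ereal m)"
      by (simp add: growth_def diff_divide_distrib del: of_nat_Suc)
    then show ?thesis using False by (intro disjI2 exI[of _ "ereal m"]) (simp add: zero_ereal_def)
  qed
next
  assume "\<exists>L. L \<noteq> 0 \<and> growth f L"
  then show ?thesis using growth_partial_sums_nonzero by metis
qed

lemma growth_funpow_partial_sums_lasso:
  assumes "ys \<noteq> []"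
  obtains L where "growth ((partial_sums ^^ k) (lasso xs ys)) L"
proof -
  let ?f = "\<lambda>k. (partial_sums ^^ k) (lasso xs ys)"
  have "eventually_periodic (?f k) \<or> (\<exists>L. L \<noteq> 0 \<and> growth (?f k) L)"
  proof (induction k)
    case (Suc k)
    then show ?case using eventually_periodic_or_growth_partial_sums[of "?f k"] by simp
  qed (simp add: eventually_periodic_lasso assms)
  then show ?thesis using that eventually_periodic_growth by blast
qed

section \<open>Growth rates under shifting and stretching\<close>

text \<open>The quotient factors through \<open>Suc (s n)\<close>; positivity of \<open>c\<close>
  rules out 0 times infinity in the limit.\<close>

lemma growth_reindex:
  assumes f: "growth f L" and s: "filterlim s at_top sequentially"
    and c: "(\<lambda>n. real (Suc (s n)) / real (Suc n)) \<longlonglongrightarrow> c" "c > 0"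
  shows "growth (\<lambda>n. f (s n)) (ereal c * L)"
proof -
  have "(\<lambda>n. ereal (f (s n) / real (Suc (s n)))) \<longlonglongrightarrow> L"
    using filterlim_compose[OF f[unfolded growth_def] s] .
  then have "(\<lambda>n. ereal (real (Suc (s n)) / real (Suc n)) * ereal (f (s n) / real (Suc (s n))))
      \<longlonglongrightarrow> ereal c * L"
    using c by (intro tendsto_mult_ereal) auto
  then show ?thesis by (simp add: growth_def del: of_nat_Suc)
qed

lemma growth_add_shift:
  assumes f: "growth f L"
  shows "growth (add_shift f) (2 * L)"
proof -
  have "(\<lambda>n. real (Suc n) / real (Suc (Suc n))) \<longlonglongrightarrow> 1"
    by (rule LIMSEQ_Suc[OF LIMSEQ_n_over_Suc_n])
  then have "(\<lambda>n. real (Suc (n - 1)) / real (Suc n)) \<longlonglongrightarrow> 1"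
    by (subst filterlim_sequentially_Suc[symmetric]) simp
  moreover have "filterlim (\<lambda>n. n - 1) at_top (sequentially :: nat filter)"
    by (rule filterlim_minus_const_nat_at_top)
  ultimately have "growth (\<lambda>n. f (n - 1)) L"
    using growth_reindex[OF f, of "\<lambda>n. n - 1" 1] by (simp add: one_ereal_def[symmetric])
  \<comment> \<open>Both limits equal \<open>L\<close>, so opposite infinities never meet.\<close>
  then have "(\<lambda>n. ereal (f n / real (Suc n)) + ereal (f (n - 1) / real (Suc n))) \<longlonglongrightarrow> L + L"
    using f unfolding growth_def by (intro tendsto_add_ereal_general) auto
  moreover have "L + L = 2 * L" by (cases L) auto
  \<comment> \<open>Index 0 is excluded: there \<open>n - 1\<close> truncates to 0, while
    \<open>add_shift\<close> adds nothing.\<close>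
  moreover have "\<forall>\<^sub>F n in sequentially. ereal (f n / real (Suc n)) + ereal (f (n - 1) / real (Suc n))
      = ereal (add_shift f n / real (Suc n))"
    using eventually_gt_at_top[of 0]
    by eventually_elim (simp add: add_shift_def add_divide_distrib)
  ultimately show ?thesis unfolding growth_def
    by (auto elim!: Lim_transform_eventually)
qed

text \<open>The sequence is \<open>f (n div 2)\<close>, so halving the index halves the rate. One
  shift is included because \<open>stretch f\<close> alone vanishes at odd indices and has no rate
  unless L = 0.\<close>

lemma growth_stretch:
  assumes f: "growth f L"
  shows "growth (add_shift (stretch f)) (ereal (1 / 2) * L)"
proof -
  have "(\<lambda>n. real (Suc (n div 2)) / real (Suc n)) \<longlonglongrightarrow> 1 / 2"
  proof (rule tendsto_sandwich)
    show "\<forall>\<^sub>F n in sequentially. 1 / 2 \<le> real (Suc (n div 2)) / real (Suc n)"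
    proof (rule always_eventually, rule allI)
      fix n :: nat
      have "Suc n \<le> 2 * Suc (n div 2)" by simp
      then have "real (Suc n) \<le> 2 * real (Suc (n div 2))" by linarith
      then show "1 / 2 \<le> real (Suc (n div 2)) / real (Suc n)" by (simp add: field_simps)
    qed
    show "\<forall>\<^sub>F n in sequentially. real (Suc (n div 2)) / real (Suc n) \<le> 1 / 2 + 1 / real (Suc n)"
    proof (rule always_eventually, rule allI)
      fix n :: nat
      have "2 * Suc (n div 2) \<le> Suc n + 2" by simp
      then have "2 * real (Suc (n div 2)) \<le> real (Suc n) + 2" by linarith
      then have "real (Suc (n div 2)) / real (Suc n) \<le> ((real (Suc n) + 2) / 2) / real (Suc n)"
        by (intro divide_right_mono) auto
      also have "\<dots> = 1 / 2 + 1 / real (Suc n)" by (simp add: field_simps)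
      finally show "real (Suc (n div 2)) / real (Suc n) \<le> 1 / 2 + 1 / real (Suc n)" .
    qed
    have "(\<lambda>n. 1 / 2 + 1 / real (Suc n)) \<longlonglongrightarrow> 1 / 2 + 0"
      by (intro tendsto_intros LIMSEQ_Suc lim_1_over_n)
    then show "(\<lambda>n. 1 / 2 + 1 / real (Suc n)) \<longlonglongrightarrow> 1 / 2" by simp
  qed simp
  moreover have "filterlim (\<lambda>n. n div 2) at_top (sequentially :: nat filter)"
    by (rule filterlim_at_top_div_const_nat) simp
  ultimately have "growth (\<lambda>n. f (n div 2)) (ereal (1 / 2) * L)"
    using growth_reindex[OF f, of "\<lambda>n. n div 2" "1 / 2"] by simp
  then show ?thesis by (simp add: add_shift_stretch[abs_def])
qed

lemma growth_funpow_add_shift: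
  assumes "growth f L"
  shows "growth ((add_shift ^^ k) f) (ereal (2 ^ k) * L)"
proof (induction k)
  case (Suc k)
  have "2 * (ereal (2 ^ k) * L) = ereal (2 ^ Suc k) * L"
    by (simp add: mult.assoc[symmetric] numeral_eq_ereal)
  then show ?case using growth_add_shift[OF Suc] by simp
qed (use assms in \<open>simp add: one_ereal_def[symmetric]\<close>)

section \<open>From growth rates to lower averages\<close>

lemma lower_average_eq:
  assumes "growth (partial_sums f) L"
  shows "lower_average f = L"
proof -
  \<comment> \<open>Passing to \<open>Suc T\<close> avoids the division by zero and matches the
    divisor in \<open>growth\<close>.\<close>
  have "(\<lambda>T. ereal ((1 / real (Suc T)) * (\<Sum>j<Suc T. f j))) \<longlonglongrightarrow> L"
    using assms by (simp add: growth_def partial_sums_def lessThan_Suc_atMost del: of_nat_Suc)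
  then have "(\<lambda>T. ereal ((1 / real T) * (\<Sum>j<T. f j))) \<longlonglongrightarrow> L"
    by (rule LIMSEQ_imp_Suc)
  then show ?thesis unfolding lower_average_def by (intro lim_imp_Liminf) auto
qed

theorem theorem3:
  fixes k :: nat and xs ys :: "real list"
  assumes "ys \<noteq> []"
  shows "phi (k + 1) (lasso (split_seq xs) (split_seq ys)) =
         ereal (2 powi (int k - 1)) * phi k (lasso xs ys)"
proof -
  let ?a = "lasso xs ys" and ?b = "lasso (split_seq xs) (split_seq ys)"
  \<comment> \<open>Averaging contributes one further summation beyond the \<open>k\<close> in
    \<open>phi k\<close>.\<close>
  let ?c = "(partial_sums ^^ Suc k) ?a"
  obtain L where L: "growth ?c L" using growth_funpow_partial_sums_lasso[OF assms] .
  have a: "phi k ?a = L" unfolding phi_def by (rule lower_average_eq) (use L in simp)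
  \<comment> \<open>The innermost of the \<open>Suc k\<close> shifts joins \<open>stretch\<close>
    for the factor 1/2; the other \<open>k\<close> double the rate.\<close>
  have "growth ((add_shift ^^ Suc k) (stretch ?c)) (ereal (2 ^ k) * (ereal (1 / 2) * L))"
    unfolding funpow_Suc_right[of k add_shift] o_apply
    by (intro growth_funpow_add_shift growth_stretch L)
  moreover have "(partial_sums ^^ Suc (Suc k)) ?b = (add_shift ^^ Suc k) (stretch ?c)"
    by (rule partial_sums_funpow_split) (rule lasso_split_seq[OF assms])
  ultimately have "growth ((partial_sums ^^ Suc (Suc k)) ?b) (ereal (2 ^ k) * (ereal (1 / 2) * L))"
    by (simp only:)
  then have "phi (k + 1) ?b = ereal (2 ^ k) * (ereal (1 / 2) * L)"
    unfolding phi_def by (intro lower_average_eq) simp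
  moreover have "(2 :: real) powi (int k - 1) = 2 ^ k / 2"
    by (simp add: power_int_diff)
  ultimately show ?thesis unfolding a by (simp only: mult.assoc[symmetric] times_ereal.simps) simp
qed

end
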